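(* Let $p>3$ be a prime, $q=p^h$, and $a,b\in\mathbb{F}_{q^2}^*$. If $\deg\gcd(N_{a,b},D_{a,b})=1$, then $f_{a,b}(X)=X(1+aX^{q(q-1)}+bX^{2(q-1)})$ is not a permutation polynomial of $\mathbb{F}_{q^2}$.
   Context: A polynomial $f\in\mathbb{F}_{q^2}[X]$ is a permutation polynomial of $\mathbb{F}_{q^2}$ if $x\mapsto f(x)$ is a bijection of $\mathbb{F}_{q^2}$. $N_{a,b}(X)=a^qX^3+X^2+b^q$ and $D_{a,b}(X)=bX^3+X+a$. *)

theory Defs
  imports "HOL-Computational_Algebra.Computational_Algebra"
begin

definition permutation_polynomial :: "'a::field poly \<Rightarrow> bool" where
  "permutation_polynomial f \<longleftrightarrow> bij (poly f)"

definition N_poly :: "nat \<Rightarrow> 'a::field \<Rightarrow> 'a \<Rightarrow> 'a poly" where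
  "N_poly q a b = [:b ^ q, 0, 1, a ^ q:]"

definition D_poly :: "'a::field \<Rightarrow> 'a \<Rightarrow> 'a poly" where
  "D_poly a b = [:a, 1, 0, b:]"

definition f_poly :: "nat \<Rightarrow> 'a::field \<Rightarrow> 'a \<Rightarrow> 'a poly" where
  "f_poly q a b = [:0, 1:] * (1 + monom a (q * (q - 1)) + monom b (2 * (q - 1)))"

end

theory Submission
  imports Defs "HOL-Number_Theory.Residues"
begin

text \<open>Let \<open>\<sigma>(u) = u^q\<close> be the Frobenius involution of \<open>F_{q^2}\<close>. Applying \<open>\<sigma>\<close> to
  \<open>N(r) = D(r) = 0\<close> and substituting \<open>1/\<sigma>(r)\<close> interchanges the two equations, so \<open>1/\<sigma>(r)\<close>
  is again a common root of \<open>N\<close> and \<open>D\<close>. If the gcd is linear the common root is unique, hence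
  \<open>r^(q+1) = 1\<close>, and by Hilbert 90 \<open>r = x^(q-1)\<close> for some \<open>x \<noteq> 0\<close>. Then
  \<open>f(x) = x (1 + a r^q + b r^2) = x r^q D(r) = 0 = f(0)\<close>, so \<open>f\<close> is not injective.\<close>

lemma poly_N_poly: "poly (N_poly q a b) x = b ^ q + x ^ 2 + a ^ q * x ^ 3"
  by (simp add: N_poly_def algebra_simps power2_eq_square power3_eq_cube)

lemma poly_D_poly: "poly (D_poly a b) x = a + x + b * x ^ 3"
  by (simp add: D_poly_def algebra_simps power3_eq_cube)

lemma poly_f_poly: "poly (f_poly q a b) x = x * (1 + a * x ^ (q * (q - 1)) + b * x ^ (2 * (q - 1)))"
  by (simp add: f_poly_def poly_monom)

text \<open>As \<open>finite_field_power_card_eq_same\<close>, which needs the sort \<open>finite_field\<close>.\<close>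
lemma power_card_UNIV_eq_self:
  fixes x :: "'a :: {field, finite}"
  shows "x ^ card (UNIV :: 'a set) = x"
proof (cases "x = 0")
  case False
  have "x * (\<Prod>y\<in>UNIV-{0}. x * y) = x * x ^ (card (UNIV :: 'a set) - 1) * \<Prod>(UNIV-{0})"
    by (simp add: prod.distrib mult_ac)
  also have "x * x ^ (card (UNIV :: 'a set) - 1) = x ^ Suc (card (UNIV :: 'a set) - 1)"
    by (subst power_Suc) auto
  also have "Suc (card (UNIV :: 'a set) - 1) = card (UNIV :: 'a set)"
    using finite_UNIV_card_ge_0[where ?'a = 'a] by simp
  also have "(\<Prod>y\<in>UNIV-{0}. x * y) = (\<Prod>y\<in>UNIV-{0}. y)"
    by (rule prod.reindex_bij_witness[of _ "\<lambda>y. y / x" "\<lambda>y. x * y"]) (use False in auto)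
  finally show ?thesis
    by simp
qed (use finite_UNIV_card_ge_0[where ?'a = 'a] in auto)

lemma degree_gcd_eq_1_imp_unique_common_root:
  fixes P Q :: "'a :: field_gcd poly"
  assumes "degree (gcd P Q) = 1"
  shows "\<exists>!r. poly P r = 0 \<and> poly Q r = 0"
proof -
  obtain c0 c1 where G: "gcd P Q = [:c0, c1:]" and "c1 \<noteq> 0"
    using degree1_coeffs[OF assms] by metis
  have "poly P s = 0 \<and> poly Q s = 0 \<longleftrightarrow> poly (gcd P Q) s = 0" for s
    by (simp add: poly_eq_0_iff_dvd)
  also have "poly (gcd P Q) s = 0 \<longleftrightarrow> s = - c0 / c1" for s
    using \<open>c1 \<noteq> 0\<close> by (auto simp: G eq_divide_eq add_eq_0_iff2 mult.commute)
  finally show ?thesis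
    by auto
qed

lemma poly_f_poly_eq_0:
  fixes a b x r :: "'a :: field"
  assumes "x ^ (q - 1) = r" and "r ^ q * r = 1" and "poly (D_poly a b) r = 0"
  shows "poly (f_poly q a b) x = 0"
proof -
  have "x ^ (q * (q - 1)) = r ^ q" and "x ^ (2 * (q - 1)) = r ^ 2"
    by (simp_all only: mult.commute[of _ "q - 1"] power_mult assms(1))
  then have "poly (f_poly q a b) x = x * (1 + a * r ^ q + b * r ^ 2)"
    by (simp only: poly_f_poly)
  also have "1 + a * r ^ q + b * r ^ 2 = r ^ q * (a + r + b * r ^ 3)"
    using assms(2) by (simp add: algebra_simps power2_eq_square power3_eq_cube)
  finally show ?thesis
    using assms(3) by (simp add: poly_D_poly)
qed

text \<open>The assumptions abstract the Frobenius map \<open>u \<mapsto> u^q\<close> of a field with \<open>q^2\<close> elements.\<close>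
context
  fixes q :: nat
  assumes power_add: "(x + y :: 'a :: field) ^ q = x ^ q + y ^ q"
    and power_power_self: "((x :: 'a) ^ q) ^ q = x"
begin

lemma frobenius_exponent_pos: "q > 0"
  using power_power_self[of 0] by (cases q) auto

lemma common_root_inverse_conj:
  fixes a b r :: 'a
  assumes N: "poly (N_poly q a b) r = 0" and D: "poly (D_poly a b) r = 0" and "r \<noteq> 0"
  shows "poly (N_poly q a b) (inverse (r ^ q)) = 0 \<and> poly (D_poly a b) (inverse (r ^ q)) = 0"
proof -
  define t where "t = r ^ q"
  have "t \<noteq> 0"
    using \<open>r \<noteq> 0\<close> by (simp add: t_def)
  have "(b ^ q + r ^ 2 + a ^ q * r ^ 3) ^ q = 0" and "(a + r + b * r ^ 3) ^ q = 0"
    using N D frobenius_exponent_pos by (simp_all add: poly_N_poly poly_D_poly)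
  then have Nt: "b + t ^ 2 + a * t ^ 3 = 0" and Dt: "a ^ q + t + b ^ q * t ^ 3 = 0"
    unfolding power_add power_mult_distrib power_power_self t_def
    by (simp_all only: power_mult[symmetric] mult.commute[of q])
  have "t ^ 3 * (a + inverse t + b * inverse t ^ 3) = b + t ^ 2 + a * t ^ 3"
    and "t ^ 3 * (b ^ q + inverse t ^ 2 + a ^ q * inverse t ^ 3) = a ^ q + t + b ^ q * t ^ 3"
    using \<open>t \<noteq> 0\<close> by (simp_all add: field_simps power2_eq_square power3_eq_cube)
  with Nt Dt \<open>t \<noteq> 0\<close> have "a + inverse t + b * inverse t ^ 3 = 0"
    and "b ^ q + inverse t ^ 2 + a ^ q * inverse t ^ 3 = 0"
    by simp_all
  then show ?thesis
    by (simp only: poly_N_poly poly_D_poly t_def)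
qed

lemma unique_common_root_norm_eq_1:
  fixes a b r :: 'a
  assumes "a \<noteq> 0" and uniq: "\<exists>!r. poly (N_poly q a b) r = 0 \<and> poly (D_poly a b) r = 0"
    and N: "poly (N_poly q a b) r = 0" and D: "poly (D_poly a b) r = 0"
  shows "r ^ q * r = 1"
proof -
  have "r \<noteq> 0"
    using D \<open>a \<noteq> 0\<close> by (auto simp: poly_D_poly)
  then have "inverse (r ^ q) = r"
    using uniq N D common_root_inverse_conj by blast
  then have "r ^ q * r = r ^ q * inverse (r ^ q)"
    by simp
  also have "\<dots> = 1"
    using \<open>r \<noteq> 0\<close> by simp
  finally show ?thesis .
qed

text \<open>Hilbert 90 for \<open>F_{q^2}/F_q\<close>: \<open>x = c + c^q/r\<close> satisfies \<open>x^q = r x\<close> for every \<open>c\<close>,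
  and \<open>x \<noteq> 0\<close> as soon as \<open>c\<close> avoids the at most \<open>q\<close> roots of \<open>X^q + r X\<close>.\<close>
lemma norm_eq_1_imp_power_pred:
  fixes r :: 'a
  assumes "finite (UNIV :: 'a set)" and "1 < q" and "q < card (UNIV :: 'a set)" and norm: "r ^ q * r = 1"
  shows "\<exists>x. x \<noteq> 0 \<and> x ^ (q - 1) = r"
proof -
  have "r \<noteq> 0"
    using norm by auto
  define P where "P = Polynomial.monom 1 q + [:0, r:]"
  have "degree P = q"
    unfolding P_def using \<open>1 < q\<close> by (subst degree_add_eq_left) (auto simp: degree_monom_eq)
  then have "card {c. poly P c = 0} \<le> q"
    using card_poly_roots_bound[of P] \<open>1 < q\<close> by fastforce
  then obtain c where "poly P c \<noteq> 0"
    using \<open>q < card (UNIV :: 'a set)\<close> by (metis (mono_tags) UNIV_eq_I mem_Collect_eq not_le)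
  then have c: "c ^ q + r * c \<noteq> 0"
    by (simp add: P_def poly_monom mult.commute)
  define x where "x = c + c ^ q / r"
  have "x * r = c ^ q + r * c"
    using \<open>r \<noteq> 0\<close> by (simp add: x_def algebra_simps)
  have "inverse (r ^ q) = r"
    using norm by (metis inverse_unique)
  have "x ^ q = c ^ q + (c ^ q / r) ^ q"
    by (simp only: x_def power_add)
  also have "(c ^ q / r) ^ q = c * inverse (r ^ q)"
    by (simp only: power_divide power_power_self) (simp only: divide_inverse)
  also have "\<dots> = c * r"
    by (simp add: \<open>inverse (r ^ q) = r\<close>)
  finally have "x ^ q = c ^ q + c * r" .
  then have xq: "x ^ q = x * r"
    using \<open>x * r = c ^ q + r * c\<close> by (simp add: mult.commute)
  have "x \<noteq> 0"
    using c \<open>x * r = c ^ q + r * c\<close> by auto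
  moreover have "x ^ (q - 1) * x = r * x"
    using power_minus_mult[of q x] xq \<open>1 < q\<close> by (simp only: mult.commute)
  ultimately show ?thesis
    by auto
qed

lemma f_poly_not_inj:
  fixes a b :: 'a
  assumes "finite (UNIV :: 'a set)" and "1 < q" and "q < card (UNIV :: 'a set)" and "a \<noteq> 0"
    and "\<exists>!r. poly (N_poly q a b) r = 0 \<and> poly (D_poly a b) r = 0"
  shows "\<not> inj (poly (f_poly q a b))"
proof -
  obtain r where N: "poly (N_poly q a b) r = 0" and D: "poly (D_poly a b) r = 0"
    using assms(5) by blast
  have "r ^ q * r = 1"
    using unique_common_root_norm_eq_1[OF \<open>a \<noteq> 0\<close> assms(5) N D] .
  then obtain x where "x \<noteq> 0" and "x ^ (q - 1) = r"
    using norm_eq_1_imp_power_pred assms(1-3) by blast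
  then have "poly (f_poly q a b) x = 0"
    using poly_f_poly_eq_0 \<open>r ^ q * r = 1\<close> D by blast
  moreover have "poly (f_poly q a b) 0 = 0"
    by (simp add: poly_f_poly)
  ultimately show ?thesis
    using \<open>x \<noteq> 0\<close> by (metis injD)
qed

end

theorem mainTheorem6:
  fixes p h q :: nat and a b :: "'a::{field_gcd,finite}"
  assumes "prime p" and "p > 3" and "h > 0" and "q = p ^ h"
    and "card (UNIV :: 'a set) = q ^ 2"
    and "a \<noteq> 0" and "b \<noteq> 0"
    and "degree (gcd (N_poly q a b) (D_poly a b)) = 1"
  shows "\<not> permutation_polynomial (f_poly q a b)"
proof -
  have char_prime: "prime CHAR('a)"
    by (rule prime_CHAR_semidom) (simp add: finite_imp_CHAR_pos)
  have "CHAR('a) dvd p ^ (h * 2)"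
    using CHAR_dvd_CARD[where 'a = 'a] assms(4,5) by (simp add: power_mult)
  then have "CHAR('a) = p"
    using char_prime assms(1) prime_dvd_power primes_dvd_imp_eq by blast
  have "1 < q"
    using assms(1,3,4) prime_gt_1_nat one_less_power by metis
  have frobenius_add: "(x + y :: 'a) ^ q = x ^ q + y ^ q" for x y
    using freshmans_dream'[OF char_prime] \<open>CHAR('a) = p\<close> assms(4) by simp
  have frobenius_involution: "((x :: 'a) ^ q) ^ q = x" for x
    using power_card_UNIV_eq_self[of x] assms(5) by (simp flip: power_mult add: power2_eq_square)
  have "q < card (UNIV :: 'a set)"
    using \<open>1 < q\<close> assms(5) by (simp add: power2_eq_square)
  then have "\<not> inj (poly (f_poly q a b))"
    by (rule f_poly_not_inj[OF frobenius_add frobenius_involution finite_UNIV \<open>1 < q\<close> _ assms(6)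
        degree_gcd_eq_1_imp_unique_common_root[OF assms(8)]])
  then show ?thesis
    unfolding permutation_polynomial_def using bij_is_inj by blast
qed

end
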